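(* Let $\omega\in(0,1)$, $n\in\mathbb{N}$, and reals $\varepsilon,\delta$. Let $A_1,A_2$ be countable sets, let $f_i:A_1\to\mathrm{Distr}(A_1)$ and $g_i:A_2\to\mathrm{Distr}(A_2)$ for $i\in[n]$, and let $\Phi_0,\Phi_1,\dots,\Phi_n\subseteq A_1\times A_2$. Suppose that for every $i\in[n]$ and every $(a_1,a_2)\in\Phi_{i-1}$ there is a symmetric $(\varepsilon,\delta)$-approximate lifting of $\Phi_i$ relating $f_i(a_1)$ and $g_i(a_2)$. Then for every $(a_1,a_2)\in\Phi_0$ there is a symmetric $(\varepsilon^*,\delta^* )$-approximate lifting of $\Phi_n$ relating $f^n(a_1)$ and $g^n(a_2)$, where $\varepsilon^*=\varepsilon\sqrt{2n\ln(1/\omega)}+n\varepsilon(e^{\varepsilon}-1)$ and $\delta^*=n\delta+\omega$.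
   Context: A sub-distribution over a countable set $A$ is $\mu:A\to[0,1]$ with $\sum_a\mu(a)\le1$; $\mathrm{Distr}(A)$ is the set of those with sum exactly $1$. $\mu(X)=\sum_{a\in X}\mu(a)$. Composition: $\mathrm{unit}(a)$ is the point mass at $a$, and $\mathrm{bind}(\mu,h)(b)=\sum_a\mu(a)h(a)(b)$; for $h_i:A\to\mathrm{Distr}(A)$, $h^0(a)=\mathrm{unit}(a)$ and $h^k(a)=\mathrm{bind}(h^{k-1}(a),h_k)$. Marginals of $\mu$ over $A_1\times A_2$ are $\pi_1(\mu)(a_1)=\sum_{a_2}\mu(a_1,a_2)$, $\pi_2(\mu)(a_2)=\sum_{a_1}\mu(a_1,a_2)$. $d_\varepsilon(\nu_1,\nu_2)=\max_{X}(\nu_1(X)-e^{\varepsilon}\nu_2(X))$. With a fresh element $\star$, $A^\star=A\cup\{\star\}$ and $Q^\star=Q\cup(A_1\times\{\star\})\cup(\{\star\}\times A_2)$ for $Q\subseteq A_1\times A_2$. A symmetric $(\varepsilon,\delta)$-approximate $Q$-lifting of $(\mu_1,\mu_2)$ exists if there are sub-distributions $\mu_L,\mu_R$ over $A_1^\star\times A_2^\star$ with $\pi_1(\mu_L)=\mu_1$, $\pi_2(\mu_R)=\mu_2$ (with $\mu_i(\star)=0$), $\mathrm{supp}(\mu_L)\cup\mathrm{supp}(\mu_R)\subseteq Q^\star$, $d_\varepsilon(\mu_L,\mu_R)\le\delta$ and $d_\varepsilon(\mu_R,\mu_L)\le\delta$.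
   Formalization: The formal theorem assumes ε ≥ 0; for ε < 0 the claim fails, e.g. n = 1, one-point A₁, A₂, Φ₀ = Φ₁ = A₁×A₂, ε = −1, δ = 1 − 1/e, ω = 0.01. *)

theory Defs
  imports "HOL-Probability.Probability"
begin

text \<open>
  Distributions over a countable set are \<^typ>\<open>'a pmf\<close> with \<^typ>\<open>'a\<close> of class \<^class>\<open>countable\<close>,
  sub-distributions are \<^typ>\<open>'a spmf\<close>. The extension of \<^typ>\<open>'a\<close> by a fresh element
  \<open>\<star>\<close> is \<^typ>\<open>'a option\<close>, with \<^term>\<open>None\<close> for \<open>\<star>\<close>; this is independent of the option type
  hidden inside \<^typ>\<open>'a spmf\<close>, which only records the missing mass.
\<close>

text \<open>The \<open>i\<close>-th kernel applied is \<open>h i\<close>, counting from 1; \<open>h 0\<close> is never used.\<close>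

primrec kleisli_iter :: "(nat \<Rightarrow> 'a \<Rightarrow> 'a pmf) \<Rightarrow> nat \<Rightarrow> 'a \<Rightarrow> 'a pmf" where
  "kleisli_iter h 0 a = return_pmf a"
| "kleisli_iter h (Suc k) a = bind_pmf (kleisli_iter h k a) (h (Suc k))"

definition dp_gap :: "real \<Rightarrow> 'a spmf \<Rightarrow> 'a spmf \<Rightarrow> 'a set \<Rightarrow> real" where
  "dp_gap \<epsilon> \<nu>1 \<nu>2 X = measure (measure_spmf \<nu>1) X - exp \<epsilon> * measure (measure_spmf \<nu>2) X"

text \<open>The supremum is a maximum, see \<open>dp_div_attained\<close> below.\<close>

definition dp_div :: "real \<Rightarrow> 'a spmf \<Rightarrow> 'a spmf \<Rightarrow> real" where
  "dp_div \<epsilon> \<nu>1 \<nu>2 = (SUP X. dp_gap \<epsilon> \<nu>1 \<nu>2 X)"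

definition star_rel :: "('a \<times> 'b) set \<Rightarrow> ('a option \<times> 'b option) set" where
  "star_rel Q = map_prod Some Some ` Q \<union> range Some \<times> {None} \<union> {None} \<times> range Some"

text \<open>
  The marginals are equated with the images of \<open>\<mu>1\<close> and \<open>\<mu>2\<close> under \<^term>\<open>Some\<close>, i.e. with
  \<open>\<mu>1\<close> and \<open>\<mu>2\<close> extended by mass 0 at \<open>\<star>\<close>.
\<close>

definition sym_approx_lifting ::
  "real \<Rightarrow> real \<Rightarrow> ('a \<times> 'b) set \<Rightarrow> 'a spmf \<Rightarrow> 'b spmf \<Rightarrow> bool" where
  "sym_approx_lifting \<epsilon> \<delta> Q \<mu>1 \<mu>2 \<longleftrightarrow>
    (\<exists>\<mu>L \<mu>R :: ('a option \<times> 'b option) spmf.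
      map_spmf fst \<mu>L = map_spmf Some \<mu>1 \<and>
      map_spmf snd \<mu>R = map_spmf Some \<mu>2 \<and>
      set_spmf \<mu>L \<union> set_spmf \<mu>R \<subseteq> star_rel Q \<and>
      dp_div \<epsilon> \<mu>L \<mu>R \<le> \<delta> \<and>
      dp_div \<epsilon> \<mu>R \<mu>L \<le> \<delta>)"

lemma measure_spmf_conv_integral:
  "measure (measure_spmf p) X = (\<integral>x. indicat_real X x * spmf p x \<partial>count_space UNIV)"
proof -
  have "measure (measure_spmf p) X = (\<integral>x. indicat_real X x \<partial>measure_spmf p)"
    by simp
  also have "\<dots> = (\<integral>x. spmf p x * indicat_real X x \<partial>count_space UNIV)"
    by (rule integral_measure_spmf)
      (auto intro!: integrable_real_indicator simp: measure_spmf.emeasure_eq_measure)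
  finally show ?thesis by (simp add: mult.commute)
qed

lemma integrable_count_space_spmf: "integrable (count_space UNIV) (spmf p)"
  by (rule integrableI_nonneg)
    (auto simp: less_top[symmetric] nn_integral_spmf_neq_top)

lemma dp_gap_le_max:
  "dp_gap \<epsilon> \<nu>1 \<nu>2 X \<le> dp_gap \<epsilon> \<nu>1 \<nu>2 {x. exp \<epsilon> * spmf \<nu>2 x < spmf \<nu>1 x}"
proof -
  have int: "integrable (count_space UNIV) (\<lambda>x. indicat_real Y x * spmf p x)" for Y and p :: "'a spmf"
    by (rule Bochner_Integration.integrable_bound[OF integrable_count_space_spmf[of p]])
      (auto simp: indicator_def)
  have eq: "dp_gap \<epsilon> \<nu>1 \<nu>2 Y =
    (\<integral>x. indicat_real Y x * spmf \<nu>1 x - exp \<epsilon> * (indicat_real Y x * spmf \<nu>2 x) \<partial>count_space UNIV)" for Y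
    unfolding dp_gap_def measure_spmf_conv_integral
    by (subst Bochner_Integration.integral_diff) (auto intro: int)
  have int_diff: "integrable (count_space UNIV)
      (\<lambda>x. indicat_real Y x * spmf \<nu>1 x - exp \<epsilon> * (indicat_real Y x * spmf \<nu>2 x))" for Y
    by (intro Bochner_Integration.integrable_diff integrable_mult_right int)
  show ?thesis
    unfolding eq by (rule integral_mono[OF int_diff int_diff]) (auto simp: indicator_def)
qed

lemma dp_div_attained: "\<exists>X. dp_div \<epsilon> \<nu>1 \<nu>2 = dp_gap \<epsilon> \<nu>1 \<nu>2 X \<and> (\<forall>Y. dp_gap \<epsilon> \<nu>1 \<nu>2 Y \<le> dp_gap \<epsilon> \<nu>1 \<nu>2 X)"
proof -
  let ?X = "{x. exp \<epsilon> * spmf \<nu>2 x < spmf \<nu>1 x}"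
  have "dp_div \<epsilon> \<nu>1 \<nu>2 = dp_gap \<epsilon> \<nu>1 \<nu>2 ?X"
    unfolding dp_div_def by (rule cSup_eq_maximum) (auto intro: dp_gap_le_max)
  then show ?thesis using dp_gap_le_max by blast
qed

end

theory Submission
  imports Defs
begin

text \<open>
  The witnesses of the one-step liftings are extended to kernels on pairs by keeping a star fixed and
  moving the other component on its own, identically on both sides; iterating the left and the right
  kernels gives witnesses for the composite, so everything reduces to advanced composition of
  indistinguishable kernels. For that, \<open>p\<close> and \<open>q\<close> are trimmed by mass at most \<open>\<delta>\<close> to
  \<open>P\<close> and \<open>Q\<close> with ratio in \<open>[e\<^sup>-\<^sup>\<epsilon>, e\<^sup>\<epsilon>]\<close> and \<open>\<parallel>P\<parallel> \<le> \<parallel>Q\<parallel>\<close>, and then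
  \<open>(P, Q) = \<alpha> (e\<^sup>\<epsilon>, 1) + \<beta> (1, e\<^sup>\<epsilon>)\<close> is a mixture of two randomized responses. Instead of tracking
  the privacy loss along histories, the induction carries the family of bounds
  \<open>p(S) \<le> e\<^sup>s q(S) + e\<^bsup>c - l s\<^esup> + d\<close> for all real \<open>s\<close>: one step costs a factor
  \<open>(e\<^sup>\<epsilon> e\<^bsup>l \<epsilon>\<^esup> + e\<^bsup>- l \<epsilon>\<^esup>) / (1 + e\<^sup>\<epsilon>)\<close>, which Hoeffding's lemma bounds, and an
  additive \<open>\<delta>\<close>. Optimising over \<open>l\<close> at the end gives the constants.
\<close>

section \<open>Indistinguishability and lossless witnesses of liftings\<close>

definition indistinguishable :: "real \<Rightarrow> real \<Rightarrow> 'z pmf \<Rightarrow> 'z pmf \<Rightarrow> bool" where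
  "indistinguishable \<epsilon> \<delta> p q \<longleftrightarrow>
    (\<forall>X. measure p X \<le> exp \<epsilon> * measure q X + \<delta> \<and> measure q X \<le> exp \<epsilon> * measure p X + \<delta>)"

lemma indistinguishable_sym: "indistinguishable \<epsilon> \<delta> p q \<Longrightarrow> indistinguishable \<epsilon> \<delta> q p"
  by (auto simp: indistinguishable_def)

lemma indistinguishable_delta_nonneg: "indistinguishable \<epsilon> \<delta> p q \<Longrightarrow> 0 \<le> \<delta>"
  by (auto simp: indistinguishable_def dest: spec[of _ "{}"])

lemma indistinguishable_mono:
  assumes "indistinguishable \<epsilon> \<delta> p q" "\<epsilon> \<le> \<epsilon>'"
  shows "indistinguishable \<epsilon>' \<delta> p q"
  unfolding indistinguishable_def
proof (intro allI conjI)
  fix X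
  have "exp \<epsilon> * measure r X \<le> exp \<epsilon>' * measure r X" for r :: "'a pmf"
    using assms(2) by (intro mult_right_mono) auto
  then show "measure p X \<le> exp \<epsilon>' * measure q X + \<delta>" "measure q X \<le> exp \<epsilon>' * measure p X + \<delta>"
    using assms(1) unfolding indistinguishable_def by (meson add_right_mono order_trans)+
qed

lemma indistinguishable_refl:
  assumes "0 \<le> \<epsilon>" "0 \<le> \<delta>"
  shows "indistinguishable \<epsilon> \<delta> p p"
proof -
  have "indistinguishable 0 \<delta> p p" using assms by (simp add: indistinguishable_def)
  then show ?thesis using assms indistinguishable_mono by blast
qed

text \<open>The supremum in \<open>dp_div\<close> is attained, so bounding it is the same as
  bounding the gap on every set.\<close>

lemma dp_div_spmf_of_pmf_le_iff:
  "dp_div \<epsilon> (spmf_of_pmf p) (spmf_of_pmf q) \<le> \<delta> \<longleftrightarrow>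
    (\<forall>X. measure p X \<le> exp \<epsilon> * measure q X + \<delta>)"
proof -
  obtain X where "dp_div \<epsilon> (spmf_of_pmf p) (spmf_of_pmf q) = dp_gap \<epsilon> (spmf_of_pmf p) (spmf_of_pmf q) X"
    and "\<forall>Y. dp_gap \<epsilon> (spmf_of_pmf p) (spmf_of_pmf q) Y \<le> dp_gap \<epsilon> (spmf_of_pmf p) (spmf_of_pmf q) X"
    using dp_div_attained by blast
  then have "dp_div \<epsilon> (spmf_of_pmf p) (spmf_of_pmf q) \<le> \<delta> \<longleftrightarrow>
      (\<forall>Y. dp_gap \<epsilon> (spmf_of_pmf p) (spmf_of_pmf q) Y \<le> \<delta>)"
    by (metis order_trans)
  then show ?thesis by (simp add: dp_gap_def algebra_simps)
qed

text \<open>Taking a marginal preserves total mass, and each of \<mu>L, \<mu>R has a prescribed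
  marginal of mass 1. So both witnesses are lossless and may be taken as
  \<open>pmf\<close>s.\<close>

lemma sym_approx_lifting_spmf_of_pmf_iff:
  "sym_approx_lifting \<epsilon> \<delta> Q (spmf_of_pmf \<mu>1) (spmf_of_pmf \<mu>2) \<longleftrightarrow>
    (\<exists>p q. map_pmf fst p = map_pmf Some \<mu>1 \<and> map_pmf snd q = map_pmf Some \<mu>2 \<and>
      set_pmf p \<union> set_pmf q \<subseteq> star_rel Q \<and> indistinguishable \<epsilon> \<delta> p q)"
    (is "?lhs \<longleftrightarrow> ?rhs")
proof -
  have inj: "spmf_of_pmf r = spmf_of_pmf s \<longleftrightarrow> r = s" for r s :: "'z pmf"
    unfolding spmf_of_pmf_def by (metis inj_Some pmf.inj_map injD)
  have lossless: "\<exists>p. \<mu> = spmf_of_pmf p"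
    if "map_spmf h \<mu> = map_spmf k (spmf_of_pmf r)"
    for \<mu> :: "'u spmf" and h :: "'u \<Rightarrow> 'v" and k :: "'w \<Rightarrow> 'v" and r
    using that by (metis lossless_map_spmf lossless_spmf_conv_spmf_of_pmf)
  show ?thesis
  proof
    assume ?lhs
    then obtain \<mu>L \<mu>R :: "('a option \<times> 'b option) spmf" where *:
      "map_spmf fst \<mu>L = map_spmf Some (spmf_of_pmf \<mu>1)"
      "map_spmf snd \<mu>R = map_spmf Some (spmf_of_pmf \<mu>2)"
      "set_spmf \<mu>L \<union> set_spmf \<mu>R \<subseteq> star_rel Q"
      "dp_div \<epsilon> \<mu>L \<mu>R \<le> \<delta>" "dp_div \<epsilon> \<mu>R \<mu>L \<le> \<delta>"
      unfolding sym_approx_lifting_def by blast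
    obtain p q where "\<mu>L = spmf_of_pmf p" "\<mu>R = spmf_of_pmf q"
      using lossless[OF *(1)] lossless[OF *(2)] by blast
    with * show ?rhs
      by (intro exI[of _ p] exI[of _ q])
        (simp add: inj dp_div_spmf_of_pmf_le_iff indistinguishable_def)
  next
    assume ?rhs
    then obtain p q where "map_pmf fst p = map_pmf Some \<mu>1" "map_pmf snd q = map_pmf Some \<mu>2"
      "set_pmf p \<union> set_pmf q \<subseteq> star_rel Q" "indistinguishable \<epsilon> \<delta> p q" by blast
    then show ?lhs unfolding sym_approx_lifting_def
      by (intro exI[of _ "spmf_of_pmf p"] exI[of _ "spmf_of_pmf q"])
        (simp add: dp_div_spmf_of_pmf_le_iff indistinguishable_def)
  qed
qed

section \<open>Integrals over composites and moments of randomized response\<close>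

text \<open>The identity is clear for nonnegative integrals; boundedness supplies the integrability
  needed to pass there and back.\<close>

lemma integral_bind_pmf_bounded:
  fixes a :: "'b \<Rightarrow> real"
  assumes "\<And>y. 0 \<le> a y" "\<And>y. a y \<le> B"
  shows "(\<integral>y. a y \<partial>bind_pmf p K) = (\<integral>x. (\<integral>y. a y \<partial>K x) \<partial>p)"
proof -
  have int: "integrable (measure_pmf r) a" for r
    by (rule measure_pmf.integrable_const_bound[where B = B]) (use assms in auto)
  have le: "(\<integral>y. a y \<partial>K x) \<le> B" for x
    using measure_pmf.integral_le_const[OF int[of "K x"], of B] assms by auto
  have "ennreal (\<integral>y. a y \<partial>bind_pmf p K) = (\<integral>\<^sup>+y. ennreal (a y) \<partial>bind_pmf p K)"
    by (rule nn_integral_eq_integral[symmetric]) (use int assms in auto)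
  also have "\<dots> = (\<integral>\<^sup>+x. (\<integral>\<^sup>+y. ennreal (a y) \<partial>K x) \<partial>p)" by simp
  also have "\<dots> = (\<integral>\<^sup>+x. ennreal (\<integral>y. a y \<partial>K x) \<partial>p)"
    by (intro nn_integral_cong nn_integral_eq_integral) (use int assms in auto)
  also have "\<dots> = ennreal (\<integral>x. (\<integral>y. a y \<partial>K x) \<partial>p)"
    by (intro nn_integral_eq_integral measure_pmf.integrable_const_bound[where B = B])
      (use le assms in \<open>auto simp: Bochner_Integration.integral_nonneg\<close>)
  finally show ?thesis
    using assms by (simp add: Bochner_Integration.integral_nonneg)
qed

text \<open>The left side is the expectation of \<open>exp (x * Z)\<close> where Z is 1 with
  probability r = \<open>exp \<epsilon> / (1 + exp \<epsilon>)\<close> and -1 otherwise. Hoeffding's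
  lemma bounds it through the mean 2r - 1 and the range 2.\<close>

lemma randomized_response_mgf:
  fixes \<epsilon> x :: real
  assumes "0 \<le> \<epsilon>" "0 \<le> x"
  shows "(exp \<epsilon> * exp x + exp (- x)) / (1 + exp \<epsilon>) \<le> exp (x * (exp \<epsilon> - 1) + x\<^sup>2 / 2)"
proof -
  define r where "r = exp \<epsilon> / (1 + exp \<epsilon>)"
  have pos: "0 < 1 + exp \<epsilon>" by (simp add: add_pos_pos)
  have r: "0 \<le> r" "r \<le> 1" using pos by (auto simp: r_def)
  \<comment> \<open>The values -x and x are shifted to 0 and 2x, which makes the width 2x.\<close>
  have "- (2 * x) * r + ln (1 + r * (exp (2 * x) - 1)) \<le> (2 * x)\<^sup>2 / 8"
    using Hoeffdings_lemma_aux[of "2 * x" r] assms r by (simp add: algebra_simps)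
  then have ln: "ln (1 + r * (exp (2 * x) - 1)) \<le> 2 * x * r + x\<^sup>2 / 2"
    by (simp add: power2_eq_square)
  have gt: "1 + r * (exp (2 * x) - 1) > 0"
    using r assms by (simp add: add_pos_nonneg)
  have "(exp \<epsilon> * exp x + exp (- x)) / (1 + exp \<epsilon>) = exp (- x) * (1 + r * (exp (2 * x) - 1))"
  proof -
    have "exp x = exp (- x) * exp (2 * x)" by (simp flip: exp_add)
    then show ?thesis using pos unfolding r_def by (simp add: field_simps)
  qed
  also have "\<dots> \<le> exp (- x) * exp (2 * x * r + x\<^sup>2 / 2)"
    using ln gt by (intro mult_left_mono) (simp_all flip: ln_le_cancel_iff add: ln_ge_iff)
  also have "\<dots> = exp (x * (2 * r - 1) + x\<^sup>2 / 2)"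
    by (simp add: algebra_simps flip: exp_add)
  also have "\<dots> \<le> exp (x * (exp \<epsilon> - 1) + x\<^sup>2 / 2)"
  proof -
    \<comment> \<open>Here 2r - 1 is (e^\<epsilon> - 1) / (e^\<epsilon> + 1); dropping the
      denominator yields the factor e^\<epsilon> - 1 of the final bound.\<close>
    have "2 * r - 1 \<le> exp \<epsilon> - 1"
      using pos assms unfolding r_def by (simp add: field_simps)
    then show ?thesis using assms by (simp add: mult_left_mono)
  qed
  finally show ?thesis .
qed

section \<open>Trimming to bounded likelihood ratios\<close>

lemma integrable_count_space_bounded_by_pmf:
  fixes P :: "'z \<Rightarrow> real"
  assumes "\<And>z. \<bar>P z\<bar> \<le> c * pmf p z"
  shows "integrable (count_space UNIV) P"
  by (rule Bochner_Integration.integrable_bound[of _ "\<lambda>z. c * pmf p z"])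
    (use assms in \<open>auto intro!: integrable_pmf AE_I2 simp: order_trans[OF assms] intro: order_trans[OF _ abs_ge_self]\<close>)

text \<open>The mass cut off by the minimum is exactly the gap on the set X where p exceeds
  e^\<epsilon> q, and the hypothesis at X bounds this gap by \<delta>.\<close>

lemma integral_pmf_truncation_ge:
  fixes p q :: "'z pmf"
  assumes "\<And>X. measure p X \<le> exp \<epsilon> * measure q X + \<delta>"
  shows "1 - \<delta> \<le> (\<integral>z. min (pmf p z) (exp \<epsilon> * pmf q z) \<partial>count_space UNIV)"
proof -
  let ?N = "count_space UNIV"
  define X where "X = {z. exp \<epsilon> * pmf q z < pmf p z}"
  have i: "integrable ?N (\<lambda>z. indicator X z * pmf r z)" for r :: "'z pmf"
    by (rule integrable_count_space_bounded_by_pmf[of _ 1 r]) (simp add: indicator_def)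
  have m: "(\<integral>z. indicator X z * pmf r z \<partial>?N) = measure r X" for r :: "'z pmf"
  proof -
    have "measure r X = (\<integral>z. indicat_real X z \<partial>r)" by simp
    also have "\<dots> = (\<integral>z. pmf r z * indicat_real X z \<partial>?N)"
      unfolding measure_pmf_eq_density by (subst integral_density) auto
    finally show ?thesis by (simp add: mult.commute)
  qed
  have "min (pmf p z) (exp \<epsilon> * pmf q z) =
      pmf p z - (indicator X z * pmf p z - exp \<epsilon> * (indicator X z * pmf q z))" for z
    by (auto simp: X_def indicator_def min_def)
  then have "(\<integral>z. min (pmf p z) (exp \<epsilon> * pmf q z) \<partial>?N) =
      1 - (measure p X - exp \<epsilon> * measure q X)"
    by (simp add: i integrable_pmf m integral_pmf)
  then show ?thesis using assms[of X] by simp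
qed


text \<open>The pointwise minima already meet every demand except the order of the masses. If that
  order fails, P is lowered until the masses agree.\<close>

lemma trim_pair_of_pmfs:
  fixes p q :: "'z pmf"
  assumes "0 \<le> \<epsilon>"
    and pq: "\<And>X. measure p X \<le> exp \<epsilon> * measure q X + \<delta>"
    and qp: "\<And>X. measure q X \<le> exp \<epsilon> * measure p X + \<delta>"
  obtains P Q :: "'z \<Rightarrow> real" where
    "\<And>z. 0 \<le> P z" "\<And>z. P z \<le> pmf p z" "\<And>z. 0 \<le> Q z" "\<And>z. Q z \<le> pmf q z"
    "\<And>z. P z \<le> exp \<epsilon> * Q z" "\<And>z. Q z \<le> exp \<epsilon> * P z"
    "(\<integral>z. P z \<partial>count_space UNIV) \<le> (\<integral>z. Q z \<partial>count_space UNIV)"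
    "1 - \<delta> \<le> (\<integral>z. P z \<partial>count_space UNIV)"
proof -
  let ?N = "count_space (UNIV :: 'z set)"
  define e where "e = exp \<epsilon>"
  have e: "1 \<le> e" "0 < e" using assms(1) by (simp_all add: e_def)
  define P where "P = (\<lambda>z. min (pmf p z) (e * pmf q z))"
  define Q where "Q = (\<lambda>z. min (pmf q z) (e * pmf p z))"
  define x where "x = (\<integral>z. P z \<partial>?N)"
  define y where "y = (\<integral>z. Q z \<partial>?N)"
  have x: "1 - \<delta> \<le> x" and y: "1 - \<delta> \<le> y"
    unfolding x_def y_def P_def Q_def e_def
    using integral_pmf_truncation_ge[OF pq] integral_pmf_truncation_ge[OF qp] by simp_all
  have nonneg: "0 \<le> P z" "0 \<le> Q z" for z using e by (auto simp: P_def Q_def)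
  have le: "P z \<le> pmf p z" "Q z \<le> pmf q z" for z by (auto simp: P_def Q_def)
  have up: "r \<le> e * r" "r \<le> e * (e * r)" if "0 \<le> r" for r
    using that e mult_right_mono[of 1 e r] mult_right_mono[of 1 e "e * r"] by linarith+
  \<comment> \<open>The minima are p against e q for P, and e q against e^2 p for e Q; since e is at
    least 1, the first lies below the second.\<close>
  have ratio: "P z \<le> e * Q z" "Q z \<le> e * P z" for z
    unfolding P_def Q_def min_mult_distrib_left using e up[of "pmf p z"] up[of "pmf q z"] by auto
  have int: "integrable ?N P" "integrable ?N Q"
    using nonneg le integrable_count_space_bounded_by_pmf[of P 1 p]
      integrable_count_space_bounded_by_pmf[of Q 1 q] by simp_all
  show ?thesis
  proof (cases "x \<le> y")
    case True
    show ?thesis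
      by (rule that[of P Q]) (use True nonneg le ratio x in \<open>simp_all add: x_def y_def e_def\<close>)
  next
    case False
    have y0: "0 \<le> y" unfolding y_def using nonneg by (simp add: Bochner_Integration.integral_nonneg)
    then have ye: "y / e \<le> y" using e by (simp add: divide_le_eq up mult.commute)
    with False have pos: "0 < x - y / e" by simp
    \<comment> \<open>Moving \<open>P\<close> towards \<open>Q / e\<close> keeps the ratio bounds; \<open>t\<close> makes the masses of \<open>P\<close> and \<open>Q\<close> equal.\<close>
    define t where "t = (y - y / e) / (x - y / e)"
    have t: "0 \<le> t" "t \<le> 1" using pos ye False by (auto simp: t_def)
    have ty: "t * (x - y / e) = y - y / e" using pos by (simp add: t_def)
    define P' where "P' = (\<lambda>z. Q z / e + t * (P z - Q z / e))"
    have d: "0 \<le> P z - Q z / e" for z using ratio(2)[of z] e by (simp add: divide_le_eq mult.commute)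
    have lower: "Q z / e \<le> P' z" for z using t d[of z] by (simp add: P'_def)
    have upper: "P' z \<le> P z" for z
      using mult_right_mono[OF t(2) d[of z]] by (simp add: P'_def)
    have iP': "(\<integral>z. P' z \<partial>?N) = y"
      unfolding P'_def using int ty by (simp flip: x_def y_def)
    show ?thesis
    \<comment> \<open>The mass of \<open>P'\<close> is y, so its lower bound 1 - \<delta> is the one
      obtained for Q.\<close>
    proof (rule that[of P' Q])
      fix z
      show "0 \<le> P' z" using lower[of z] nonneg(2)[of z] e by (meson divide_nonneg_pos order_trans)
      show "P' z \<le> pmf p z" using upper[of z] le(1)[of z] by simp
      show "P' z \<le> exp \<epsilon> * Q z" using upper[of z] ratio(1)[of z] by (simp add: e_def)
      show "Q z \<le> exp \<epsilon> * P' z" using lower[of z] e by (simp add: e_def divide_le_eq mult.commute)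
    qed (use nonneg le y iP' in \<open>simp_all flip: y_def\<close>)
  qed
qed

section \<open>One step of advanced composition\<close>

text \<open>
  A test with the multiplier \<open>u\<close> before the step is paid for by tests with the multipliers
  \<open>u e\<^sup>-\<^sup>\<epsilon>\<close> and \<open>u e\<^sup>\<epsilon>\<close> after it, one for each of the two randomized responses.
\<close>

lemma advanced_composition_step:
  fixes p q :: "'z pmf" and a b :: "'z \<Rightarrow> real"
  assumes eps: "0 < \<epsilon>"
    and pq: "\<And>X. measure p X \<le> exp \<epsilon> * measure q X + \<delta>"
    and qp: "\<And>X. measure q X \<le> exp \<epsilon> * measure p X + \<delta>"
    and a: "\<And>z. 0 \<le> a z" "\<And>z. a z \<le> 1" and b: "\<And>z. 0 \<le> b z" "\<And>z. b z \<le> 1"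
    and u: "0 \<le> u" and W: "0 \<le> W2" "W2 \<le> W1"
    and lo: "\<And>z. z \<in> set_pmf p \<Longrightarrow> a z \<le> u / exp \<epsilon> * b z + W1"
    and hi: "\<And>z. z \<in> set_pmf p \<Longrightarrow> a z \<le> u * exp \<epsilon> * b z + W2"
  shows "(\<integral>z. a z \<partial>p) \<le> u * (\<integral>z. b z \<partial>q) + (exp \<epsilon> * W1 + W2) / (1 + exp \<epsilon>) + \<delta>"
proof -
  let ?N = "count_space (UNIV :: 'z set)"
  obtain P Q where PQ: "\<And>z. 0 \<le> P z" "\<And>z. P z \<le> pmf p z" "\<And>z. 0 \<le> Q z" "\<And>z. Q z \<le> pmf q z"
    "\<And>z. P z \<le> exp \<epsilon> * Q z" "\<And>z. Q z \<le> exp \<epsilon> * P z"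
    "(\<integral>z. P z \<partial>?N) \<le> (\<integral>z. Q z \<partial>?N)" "1 - \<delta> \<le> (\<integral>z. P z \<partial>?N)"
    using trim_pair_of_pmfs[OF less_imp_le[OF eps] pq qp] by blast
  define e where "e = exp \<epsilon>"
  have e: "1 < e" "0 < e" using eps by (simp_all add: e_def)
  have d: "0 < e\<^sup>2 - 1" using e by (simp add: one_less_power)
  \<comment> \<open>\<alpha> and \<beta> solve P = e \<alpha> + \<beta>, Q = \<alpha> + e \<beta>,
    whose determinant e^2 - 1 is positive as \<epsilon> > 0. Their nonnegativity is precisely the
    two ratio bounds.\<close>
  define \<alpha> where "\<alpha> = (\<lambda>z. (e * P z - Q z) / (e\<^sup>2 - 1))"
  define \<beta> where "\<beta> = (\<lambda>z. (e * Q z - P z) / (e\<^sup>2 - 1))"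
  have ab0: "0 \<le> \<alpha> z" "0 \<le> \<beta> z" for z
    using d PQ(5,6)[of z] by (simp_all add: \<alpha>_def \<beta>_def e_def)
  have P: "P z = e * \<alpha> z + \<beta> z" and Q: "Q z = \<alpha> z + e * \<beta> z" for z
  proof -
    have "e * (e * P z - Q z) + (e * Q z - P z) = P z * (e\<^sup>2 - 1)"
      "(e * P z - Q z) + e * (e * Q z - P z) = Q z * (e\<^sup>2 - 1)"
      by (simp_all add: algebra_simps power2_eq_square)
    then show "P z = e * \<alpha> z + \<beta> z" "Q z = \<alpha> z + e * \<beta> z"
      using d by (simp_all add: \<alpha>_def \<beta>_def eq_divide_eq flip: add_divide_distrib)
  qed
  \<comment> \<open>The coefficients of P and -Q when e \<alpha> W1 + \<beta> W2 is rewritten by the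
    definitions of \<alpha> and \<beta>.\<close>
  define c1 where "c1 = (e\<^sup>2 * W1 - W2) / (e\<^sup>2 - 1)"
  define c2 where "c2 = (e * W1 - e * W2) / (e\<^sup>2 - 1)"
  \<comment> \<open>On the \<alpha> part, P outweighs Q by e, which cancels the divisor in
    \<open>lo\<close>; on the \<beta> part, Q outweighs P by e, which matches the factor in
    \<open>hi\<close>. The test terms add up to u Q b.\<close>
  have point: "P z * a z \<le> u * (Q z * b z) + (c1 * P z - c2 * Q z)" for z
  proof (cases "z \<in> set_pmf p")
    case True
    have "P z * a z = e * \<alpha> z * a z + \<beta> z * a z" by (simp add: P algebra_simps)
    also have "\<dots> \<le> e * \<alpha> z * (u / e * b z + W1) + \<beta> z * (u * e * b z + W2)"
      using lo[OF True] hi[OF True] ab0[of z] e by (intro add_mono mult_left_mono) (auto simp: e_def)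
    also have "\<dots> = u * (Q z * b z) + (e * \<alpha> z * W1 + \<beta> z * W2)"
      using e by (simp add: Q algebra_simps)
    also have "e * \<alpha> z * W1 + \<beta> z * W2 = c1 * P z - c2 * Q z"
      using d by (simp add: \<alpha>_def \<beta>_def c1_def c2_def field_simps power2_eq_square)
    finally show ?thesis .
  next
    case False
    then have "P z = 0" using PQ(1,2)[of z] by (simp add: set_pmf_iff)
    moreover have "Q z = 0" using PQ(3,6)[of z] \<open>P z = 0\<close> by simp
    ultimately show ?thesis by simp
  qed
  have bd: "\<bar>x * y\<bar> \<le> m" if "0 \<le> x" "x \<le> m" "0 \<le> y" "y \<le> 1" for x y m :: real
    using that mult_mono[of x m y 1] by simp
  have int: "integrable ?N P" "integrable ?N Q" "integrable ?N (\<lambda>z. P z * a z)"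
    "integrable ?N (\<lambda>z. Q z * b z)" "integrable ?N (\<lambda>z. pmf p z * a z)"
    "integrable ?N (\<lambda>z. pmf q z * b z)"
    using PQ a b by (auto intro!: integrable_count_space_bounded_by_pmf[of P 1 p]
        integrable_count_space_bounded_by_pmf[of Q 1 q]
        integrable_count_space_bounded_by_pmf[of "\<lambda>z. P z * a z" 1 p]
        integrable_count_space_bounded_by_pmf[of "\<lambda>z. Q z * b z" 1 q]
        integrable_count_space_bounded_by_pmf[of "\<lambda>z. pmf p z * a z" 1 p]
        integrable_count_space_bounded_by_pmf[of "\<lambda>z. pmf q z * b z" 1 q] bd)
  have exp_conv: "(\<integral>z. h z \<partial>r) = (\<integral>z. pmf r z * h z \<partial>?N)" for h :: "'z \<Rightarrow> real" and r :: "'z pmf"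
    unfolding measure_pmf_eq_density by (subst integral_density) auto
  define x where "x = (\<integral>z. P z \<partial>?N)"
  define y where "y = (\<integral>z. Q z \<partial>?N)"
  \<comment> \<open>Since a is at most 1, the mass trimmed from p contributes at most 1 - x, hence
    at most \<delta>.\<close>
  have "(\<integral>z. pmf p z * a z \<partial>?N) \<le> (\<integral>z. P z * a z + (pmf p z - P z) \<partial>?N)"
  proof (rule integral_mono)
    fix z
    have "(pmf p z - P z) * a z \<le> pmf p z - P z" using PQ(2)[of z] a by (intro mult_left_le) auto
    then show "pmf p z * a z \<le> P z * a z + (pmf p z - P z)" by (simp add: algebra_simps)
  qed (intro Bochner_Integration.integrable_add Bochner_Integration.integrable_diff int integrable_pmf)+
  also have "\<dots> = (\<integral>z. P z * a z \<partial>?N) + (1 - x)"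
    using int by (simp add: integrable_pmf integral_pmf x_def)
  also have "\<dots> \<le> (\<integral>z. P z * a z \<partial>?N) + \<delta>" using PQ(8) by (simp add: x_def)
  also have "(\<integral>z. P z * a z \<partial>?N) \<le> (\<integral>z. u * (Q z * b z) + (c1 * P z - c2 * Q z) \<partial>?N)"
    by (rule integral_mono) (use int point in auto)
  also have "\<dots> = u * (\<integral>z. Q z * b z \<partial>?N) + (c1 * x - c2 * y)"
    using int by (simp add: x_def y_def)
  also have "(\<integral>z. Q z * b z \<partial>?N) \<le> (\<integral>z. pmf q z * b z \<partial>?N)"
    by (rule integral_mono) (use int PQ b in \<open>auto intro!: mult_right_mono\<close>)
  \<comment> \<open>The order of the masses enters here: c1 is nonnegative, so x may be raised to y.
    Then c1 - c2 is the desired average, and y is at most 1.\<close>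
  also have "c1 * x - c2 * y \<le> (e * W1 + W2) / (1 + e)"
  proof -
    have "W2 \<le> e\<^sup>2 * W1"
      using W d mult_right_mono[of 1 "e\<^sup>2" W1] by simp
    then have c1: "0 \<le> c1" using d by (simp add: c1_def)
    have y1: "y \<le> 1"
      using integral_mono[OF int(2) integrable_pmf[of UNIV q]] PQ(4) by (simp add: y_def integral_pmf)
    have "c1 * x - c2 * y \<le> c1 * y - c2 * y"
      using c1 PQ(7) by (simp add: x_def y_def mult_left_mono)
    also have "\<dots> = y * ((e * W1 + W2) / (1 + e))"
    proof -
      have "c1 - c2 = (e * W1 + W2) * (e - 1) / ((1 + e) * (e - 1))"
        by (simp add: c1_def c2_def power2_eq_square algebra_simps flip: diff_divide_distrib)
      also have "\<dots> = (e * W1 + W2) / (1 + e)" using e by simp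
      finally show ?thesis by (metis left_diff_distrib mult.commute)
    qed
    also have "\<dots> \<le> (e * W1 + W2) / (1 + e)"
      using y1 e W by (intro mult_right_le_one_le mult_left_le_one_le)
        (auto simp: y_def PQ(3) Bochner_Integration.integral_nonneg)
    finally show ?thesis .
  qed
  finally show ?thesis
    using u by (simp add: exp_conv e_def mult_left_mono)
qed


section \<open>Advanced composition of kernels\<close>

text \<open>The induction peels off the last kernel and absorbs it into the tests, replacing a and b
  by their expectations after that step. This is why tests are [0,1]-valued functions instead of
  sets, and why the premise ranges over all s although the conclusion fixes one.\<close>

lemma kleisli_iter_test_function_bound:
  fixes K L :: "nat \<Rightarrow> 'z \<Rightarrow> 'z pmf" and a b :: "'z \<Rightarrow> real"
  assumes "0 < \<epsilon>" "0 \<le> \<delta>" "0 \<le> l" "0 \<le> d"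
    and "\<forall>i\<in>{1..n}. \<forall>z\<in>\<Psi> (i - 1). set_pmf (K i z) \<subseteq> \<Psi> i \<and> indistinguishable \<epsilon> \<delta> (K i z) (L i z)"
    and "\<And>z. 0 \<le> a z" "\<And>z. a z \<le> 1" "\<And>z. 0 \<le> b z" "\<And>z. b z \<le> 1"
    and "\<And>z s. z \<in> \<Psi> n \<Longrightarrow> a z \<le> exp s * b z + exp (c - l * s) + d"
    and "z \<in> \<Psi> 0"
  shows "(\<integral>y. a y \<partial>kleisli_iter K n z) \<le> exp s * (\<integral>y. b y \<partial>kleisli_iter L n z)
    + exp (c + real n * (l * \<epsilon> * (exp \<epsilon> - 1) + (l * \<epsilon>)\<^sup>2 / 2) - l * s) + d + real n * \<delta>"
  using assms(4-)
proof (induction n arbitrary: a b c d)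
  case 0
  then show ?case by simp
next
  case (Suc n)
  define \<kappa> where "\<kappa> = l * \<epsilon> * (exp \<epsilon> - 1) + (l * \<epsilon>)\<^sup>2 / 2"
  define a' where "a' = (\<lambda>y. \<integral>x. a x \<partial>K (Suc n) y)"
  define b' where "b' = (\<lambda>y. \<integral>x. b x \<partial>L (Suc n) y)"
  have int: "integrable (measure_pmf r) a" "integrable (measure_pmf r) b" for r
    using Suc.prems(3-6) by (auto intro!: measure_pmf.integrable_const_bound[where B = 1])
  have range: "0 \<le> a' y" "a' y \<le> 1" "0 \<le> b' y" "b' y \<le> 1" for y
    unfolding a'_def b'_def using Suc.prems(3-6) int
    by (auto intro!: Bochner_Integration.integral_nonneg measure_pmf.integral_le_const)
  have step: "a' y \<le> exp t * b' y + exp (c + \<kappa> - l * t) + (d + \<delta>)" if y: "y \<in> \<Psi> n" for y t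
  proof -
    have K: "set_pmf (K (Suc n) y) \<subseteq> \<Psi> (Suc n)"
      and ind: "indistinguishable \<epsilon> \<delta> (K (Suc n) y) (L (Suc n) y)"
      using Suc.prems(2) y by force+
    \<comment> \<open>The slack at exponent r. It decreases in r because l is nonnegative, which
      orders the slacks at t - \<epsilon> and t + \<epsilon>.\<close>
    define W where "W = (\<lambda>r. exp (c - l * r) + d)"
    have W: "0 \<le> W r" for r using Suc.prems(1) by (simp add: W_def add_nonneg_nonneg)
    have "a' y \<le> exp t * b' y + (exp \<epsilon> * W (t - \<epsilon>) + W (t + \<epsilon>)) / (1 + exp \<epsilon>) + \<delta>"
      unfolding a'_def b'_def
    proof (rule advanced_composition_step[OF assms(1)])
      show "W (t + \<epsilon>) \<le> W (t - \<epsilon>)" using assms(1,3) by (simp add: W_def mult_left_mono)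
      show "a x \<le> exp t / exp \<epsilon> * b x + W (t - \<epsilon>)" if "x \<in> set_pmf (K (Suc n) y)" for x
        using Suc.prems(7)[of x "t - \<epsilon>"] that K by (auto simp: W_def exp_diff)
      show "a x \<le> exp t * exp \<epsilon> * b x + W (t + \<epsilon>)" if "x \<in> set_pmf (K (Suc n) y)" for x
        using Suc.prems(7)[of x "t + \<epsilon>"] that K by (auto simp: W_def exp_add)
    qed (use ind W Suc.prems in \<open>auto simp: indistinguishable_def\<close>)
    also have "(exp \<epsilon> * W (t - \<epsilon>) + W (t + \<epsilon>)) / (1 + exp \<epsilon>) =
        exp (c - l * t) * ((exp \<epsilon> * exp (l * \<epsilon>) + exp (- (l * \<epsilon>))) / (1 + exp \<epsilon>)) + d"
    proof -
      have "1 + exp \<epsilon> \<noteq> 0" by (metis add_pos_pos exp_gt_zero less_irrefl zero_less_one)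
      moreover have "exp (c - l * (t - \<epsilon>)) = exp (c - l * t) * exp (l * \<epsilon>)"
        "exp (c - l * (t + \<epsilon>)) = exp (c - l * t) * exp (- (l * \<epsilon>))"
        by (simp_all add: algebra_simps flip: exp_add)
      ultimately show ?thesis by (simp add: W_def divide_simps) (simp add: algebra_simps)
    qed
    also have "\<dots> \<le> exp (c - l * t) * exp \<kappa> + d"
      using randomized_response_mgf[of \<epsilon> "l * \<epsilon>"] assms(1,3)
      unfolding \<kappa>_def by (intro add_right_mono mult_left_mono) auto
    also have "\<dots> = exp (c + \<kappa> - l * t) + d" by (simp add: algebra_simps flip: exp_add)
    finally show ?thesis by simp
  qed
  have unroll: "(\<integral>y. a y \<partial>kleisli_iter K (Suc n) z) = (\<integral>y. a' y \<partial>kleisli_iter K n z)"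
    "(\<integral>y. b y \<partial>kleisli_iter L (Suc n) z) = (\<integral>y. b' y \<partial>kleisli_iter L n z)"
    unfolding a'_def b'_def kleisli_iter.simps
    by (rule integral_bind_pmf_bounded[where B = 1]; use Suc.prems in simp)+
  \<comment> \<open>The absorbed step has raised c by \<kappa> and d by \<delta>.\<close>
  have IH: "(\<integral>y. a' y \<partial>kleisli_iter K n z) \<le> exp s * (\<integral>y. b' y \<partial>kleisli_iter L n z)
      + exp (c + \<kappa> + real n * \<kappa> - l * s) + (d + \<delta>) + real n * \<delta>"
    unfolding \<kappa>_def
    by (rule Suc.IH) (use Suc.prems step range assms(2) in \<open>auto simp: \<kappa>_def\<close>)
  have "c + real (Suc n) * \<kappa> - l * s = c + \<kappa> + real n * \<kappa> - l * s"
    "real (Suc n) * \<delta> = \<delta> + real n * \<delta>"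
    by (simp_all add: algebra_simps)
  with IH show ?case
    unfolding \<kappa>_def[symmetric] unroll by (simp only: add.assoc)
qed

lemma advanced_composition_pos:
  fixes K L :: "nat \<Rightarrow> 'z \<Rightarrow> 'z pmf"
  assumes eps: "0 < \<epsilon>" and delta: "0 \<le> \<delta>" and omega: "0 < \<omega>" "\<omega> < 1" and n: "0 < n"
    and K: "\<forall>i\<in>{1..n}. \<forall>z\<in>\<Psi> (i - 1). set_pmf (K i z) \<subseteq> \<Psi> i \<and> indistinguishable \<epsilon> \<delta> (K i z) (L i z)"
    and z: "z \<in> \<Psi> 0"
  shows "measure (kleisli_iter K n z) X \<le>
    exp (\<epsilon> * sqrt (2 * real n * ln (1 / \<omega>)) + real n * \<epsilon> * (exp \<epsilon> - 1)) * measure (kleisli_iter L n z) X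
      + (real n * \<delta> + \<omega>)"
proof -
  define v where "v = ln (1 / \<omega>)"
  have v: "0 \<le> v" using omega by (simp add: v_def)
  \<comment> \<open>With v = ln (1 / \<omega>) and the s below, the exponent is n (l \<epsilon>)^2 /
    2 - l \<epsilon> sqrt (2 n v). It is minimal at l \<epsilon> = sqrt (2 v / n), where its value
    is -v.\<close>
  define l where "l = sqrt (2 * v / n) / \<epsilon>"
  define s where "s = \<epsilon> * sqrt (2 * real n * v) + real n * \<epsilon> * (exp \<epsilon> - 1)"
  have le: "l * \<epsilon> = sqrt (2 * v / n)" using eps by (simp add: l_def)
  have l: "0 \<le> l" using eps v by (simp add: l_def)
  \<comment> \<open>Before any step both tests are the indicator of X: for t at least 0 the factor
    exp t suffices, for negative t the additive term is already at least 1.\<close>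
  have base: "indicator X y \<le> exp t * indicator X y + exp (0 - l * t) + (0 :: real)" for y t
  proof (cases "0 \<le> t")
    case True
    then show ?thesis by (simp add: indicator_def add_increasing2)
  next
    case False
    then have "0 \<le> - (l * t)" using l by (simp add: mult_nonneg_nonpos)
    then have "1 \<le> exp (0 - l * t)" by simp
    then show ?thesis by (auto simp: indicator_def intro: add_increasing)
  qed
  have "(\<integral>y. indicator X y \<partial>kleisli_iter K n z) \<le> exp s * (\<integral>y. indicator X y \<partial>kleisli_iter L n z)
    + exp (0 + real n * (l * \<epsilon> * (exp \<epsilon> - 1) + (l * \<epsilon>)\<^sup>2 / 2) - l * s) + 0 + real n * \<delta>"
    by (rule kleisli_iter_test_function_bound[OF eps delta l order_refl K _ _ _ _ _ z])
      (use base in \<open>auto simp: indicator_def\<close>)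
  also have "0 + real n * (l * \<epsilon> * (exp \<epsilon> - 1) + (l * \<epsilon>)\<^sup>2 / 2) - l * s = - v"
  proof -
    have "(l * \<epsilon>) * sqrt (2 * real n * v) = 2 * v"
      unfolding le using n v
      by (simp add: real_sqrt_mult[symmetric] power2_eq_square[symmetric] real_sqrt_unique)
    moreover have "real n * ((l * \<epsilon>)\<^sup>2 / 2) = v"
      unfolding le using n v by simp
    moreover have "l * s = (l * \<epsilon>) * sqrt (2 * real n * v) + real n * (l * \<epsilon> * (exp \<epsilon> - 1))"
      by (simp add: s_def algebra_simps)
    ultimately show ?thesis by (simp add: distrib_left)
  qed
  also have "exp (- v) = \<omega>" using omega by (simp add: v_def ln_div)
  finally show ?thesis by (simp add: s_def v_def)
qed

text \<open>Both kernels keep \<Psi> invariant, so the one-sided bound applies in either order of K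
  and L.\<close>

lemma advanced_composition:
  fixes K L :: "nat \<Rightarrow> 'z \<Rightarrow> 'z pmf"
  assumes eps: "0 \<le> \<epsilon>" and omega: "0 < \<omega>" "\<omega> < 1"
    and K: "\<forall>i\<in>{1..n}. \<forall>z\<in>\<Psi> (i - 1).
      set_pmf (K i z) \<union> set_pmf (L i z) \<subseteq> \<Psi> i \<and> indistinguishable \<epsilon> \<delta> (K i z) (L i z)"
    and z: "z \<in> \<Psi> 0"
  shows "indistinguishable (\<epsilon> * sqrt (2 * real n * ln (1 / \<omega>)) + real n * \<epsilon> * (exp \<epsilon> - 1))
    (real n * \<delta> + \<omega>) (kleisli_iter K n z) (kleisli_iter L n z)"
proof (cases "n = 0")
  case True
  then show ?thesis using omega by (auto intro: indistinguishable_refl)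
next
  case False
  \<comment> \<open>Read off from the first kernels at z, hence only for n > 0. For n = 0 both
    iterates are the same point mass and the additive bound is \<omega>.\<close>
  have delta: "0 \<le> \<delta>"
    using False K z by (force dest!: bspec[of _ _ 1] intro: indistinguishable_delta_nonneg)
  define E where "E = (\<lambda>x. x * sqrt (2 * real n * ln (1 / \<omega>)) + real n * x * (exp x - 1))"
  have pos: "indistinguishable (E x) (real n * \<delta> + \<omega>) (kleisli_iter K n z) (kleisli_iter L n z)"
    if "\<epsilon> < x" for x
  proof -
    have KL: "\<forall>i\<in>{1..n}. \<forall>z\<in>\<Psi> (i - 1). set_pmf (K i z) \<subseteq> \<Psi> i \<and> indistinguishable x \<delta> (K i z) (L i z)"
      "\<forall>i\<in>{1..n}. \<forall>z\<in>\<Psi> (i - 1). set_pmf (L i z) \<subseteq> \<Psi> i \<and> indistinguishable x \<delta> (L i z) (K i z)"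
      using K indistinguishable_mono[OF _ less_imp_le[OF that]] indistinguishable_sym by blast+
    have "0 < x" "0 < n" using that eps False by auto
    from advanced_composition_pos[OF this(1) delta omega this(2) KL(1) z]
      advanced_composition_pos[OF this(1) delta omega this(2) KL(2) z]
    show ?thesis unfolding indistinguishable_def E_def by blast
  qed
  \<comment> \<open>The optimal \<open>l\<close> is infinite at \<open>\<epsilon> = 0\<close>, so this case is reached as a limit.\<close>
  have lim: "((\<lambda>x. exp (E x) * m + (real n * \<delta> + \<omega>)) \<longlongrightarrow> exp (E \<epsilon>) * m + (real n * \<delta> + \<omega>)) (at_right \<epsilon>)" for m
    unfolding E_def by (intro tendsto_intros)
  have ev: "eventually (\<lambda>x. \<epsilon> < x) (at_right \<epsilon>)"
    by (simp add: eventually_at_right_less)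
  have "indistinguishable (E \<epsilon>) (real n * \<delta> + \<omega>) (kleisli_iter K n z) (kleisli_iter L n z)"
    unfolding indistinguishable_def
    by (intro allI conjI; rule tendsto_lowerbound[OF lim])
      (use ev pos in \<open>auto simp: indistinguishable_def elim!: eventually_mono\<close>)
  then show ?thesis by (simp add: E_def)
qed

section \<open>Kernels on starred pairs and their marginals\<close>

text \<open>For \<open>h\<close> being \<open>fst\<close> or \<open>snd\<close>, a chain started at
  a non-star value of \<open>h\<close> never reaches a star in that component, because its
  projection is an image under \<open>Some\<close>. So agreement with f at non-star values
  determines the marginal.\<close>

lemma kleisli_iter_projection:
  assumes "\<forall>i\<in>{1..n}. \<forall>z\<in>\<Psi> (i - 1). set_pmf (K i z) \<subseteq> \<Psi> i \<and>
      (\<forall>a. h z = Some a \<longrightarrow> map_pmf h (K i z) = map_pmf Some (f i a))"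
    and "z \<in> \<Psi> 0" and "h z = Some a"
  shows "set_pmf (kleisli_iter K n z) \<subseteq> \<Psi> n \<and>
    map_pmf h (kleisli_iter K n z) = map_pmf Some (kleisli_iter f n a)"
  using assms
proof (induction n)
  case 0
  then show ?case by simp
next
  case (Suc n)
  let ?p = "kleisli_iter K n z"
  have IH: "set_pmf ?p \<subseteq> \<Psi> n" "map_pmf h ?p = map_pmf Some (kleisli_iter f n a)"
    using Suc by auto
  have K: "set_pmf (K (Suc n) y) \<subseteq> \<Psi> (Suc n)"
    "h y = Some b \<Longrightarrow> map_pmf h (K (Suc n) y) = map_pmf Some (f (Suc n) b)" if "y \<in> \<Psi> n" for y b
    using Suc.prems(1) that by force+
  have some: "\<exists>b. h y = Some b" if "y \<in> set_pmf ?p" for y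
    using that arg_cong[OF IH(2), of set_pmf] by auto
  have "map_pmf h (kleisli_iter K (Suc n) z) = bind_pmf ?p (\<lambda>y. map_pmf h (K (Suc n) y))"
    by (simp add: map_bind_pmf)
  \<comment> \<open>\<open>the\<close> meets only values of the form \<open>Some b\<close> on the
    support of \<open>?p\<close>.\<close>
  also have "\<dots> = bind_pmf ?p (\<lambda>y. map_pmf Some (f (Suc n) (the (h y))))"
    by (rule bind_pmf_cong[OF refl]) (use IH(1) K some in fastforce)
  also have "\<dots> = bind_pmf (map_pmf h ?p) (\<lambda>x. map_pmf Some (f (Suc n) (the x)))"
    by (simp add: bind_map_pmf)
  also have "\<dots> = map_pmf Some (kleisli_iter f (Suc n) a)"
    by (simp add: IH(2) bind_map_pmf map_bind_pmf)
  finally show ?case using IH(1) K(1) by auto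
qed

text \<open>At a pair in \<Phi> the witnesses of the lifting serve. At a star, p and q are the same
  distribution, so they are indistinguishable by reflexivity, and only the non-star component has a
  marginal to match.\<close>

lemma star_extension_of_lifting:
  assumes "0 \<le> \<epsilon>" "0 \<le> \<delta>"
    and lift: "\<forall>(a, b)\<in>\<Phi>. sym_approx_lifting \<epsilon> \<delta> \<Phi>' (spmf_of_pmf (f a)) (spmf_of_pmf (g b))"
    and z: "z \<in> star_rel \<Phi>"
  shows "\<exists>p q. set_pmf p \<union> set_pmf q \<subseteq> star_rel \<Phi>' \<and> indistinguishable \<epsilon> \<delta> p q \<and>
    (\<forall>a. fst z = Some a \<longrightarrow> map_pmf fst p = map_pmf Some (f a)) \<and>
    (\<forall>b. snd z = Some b \<longrightarrow> map_pmf snd q = map_pmf Some (g b))"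
proof -
  consider a b where "z = (Some a, Some b)" "(a, b) \<in> \<Phi>" | a where "z = (Some a, None)"
    | b where "z = (None, Some b)"
    using z unfolding star_rel_def by fastforce
  then show ?thesis
  proof cases
    case 1
    then show ?thesis
      using lift unfolding sym_approx_lifting_spmf_of_pmf_iff by fastforce
  next
    case (2 a)
    then show ?thesis
      using assms(1,2)
      by (intro exI[of _ "map_pmf (\<lambda>x. (Some x, None)) (f a)"])
        (auto simp: star_rel_def map_pmf_comp indistinguishable_refl)
  next
    case (3 b)
    then show ?thesis
      using assms(1,2)
      by (intro exI[of _ "map_pmf (\<lambda>y. (None, Some y)) (g b)"])
        (auto simp: star_rel_def map_pmf_comp indistinguishable_refl)
  qed
qed

theorem theorem5p27:
  fixes \<omega> \<epsilon> \<delta> :: real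
    and n :: nat
    and f :: "nat \<Rightarrow> 'a::countable \<Rightarrow> 'a pmf"
    and g :: "nat \<Rightarrow> 'b::countable \<Rightarrow> 'b pmf"
    and \<Phi> :: "nat \<Rightarrow> ('a \<times> 'b) set"
  assumes "0 < \<omega>" and "\<omega> < 1"
    and "0 \<le> \<epsilon>"
    and "\<forall>i\<in>{1..n}. \<forall>(a1, a2)\<in>\<Phi> (i - 1).
           sym_approx_lifting \<epsilon> \<delta> (\<Phi> i) (spmf_of_pmf (f i a1)) (spmf_of_pmf (g i a2))"
  shows "\<forall>(a1, a2)\<in>\<Phi> 0.
           sym_approx_lifting
             (\<epsilon> * sqrt (2 * real n * ln (1 / \<omega>)) + real n * \<epsilon> * (exp \<epsilon> - 1))
             (real n * \<delta> + \<omega>)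
             (\<Phi> n)
             (spmf_of_pmf (kleisli_iter f n a1)) (spmf_of_pmf (kleisli_iter g n a2))"
proof clarify
  fix a1 a2
  assume a: "(a1, a2) \<in> \<Phi> 0"
  \<comment> \<open>Some i in {1..n} forces n > 0, so the lifting assumed for the first step at (a1,
    a2) exists and yields the sign.\<close>
  have delta: "0 \<le> \<delta>" if "i \<in> {1..n}" for i
  proof -
    have "sym_approx_lifting \<epsilon> \<delta> (\<Phi> 1) (spmf_of_pmf (f 1 a1)) (spmf_of_pmf (g 1 a2))"
      using assms(4) a that by force
    then show ?thesis
      unfolding sym_approx_lifting_spmf_of_pmf_iff by (auto intro: indistinguishable_delta_nonneg)
  qed
  define \<Psi> where "\<Psi> = (\<lambda>i. star_rel (\<Phi> i))"
  \<comment> \<open>The premise stands inside the quantifiers so that choice yields total kernels K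
    and L.\<close>
  have "\<exists>p q. i \<in> {1..n} \<and> z \<in> \<Psi> (i - 1) \<longrightarrow>
      set_pmf p \<union> set_pmf q \<subseteq> \<Psi> i \<and> indistinguishable \<epsilon> \<delta> p q \<and>
      (\<forall>a. fst z = Some a \<longrightarrow> map_pmf fst p = map_pmf Some (f i a)) \<and>
      (\<forall>b. snd z = Some b \<longrightarrow> map_pmf snd q = map_pmf Some (g i b))" for i z
    using star_extension_of_lifting[OF assms(3) delta, of i "\<Phi> (i - 1)" "\<Phi> i" "f i" "g i" z] assms(4)
    unfolding \<Psi>_def by blast
  then obtain K L where KL: "\<And>i z. i \<in> {1..n} \<and> z \<in> \<Psi> (i - 1) \<longrightarrow>
      set_pmf (K i z) \<union> set_pmf (L i z) \<subseteq> \<Psi> i \<and> indistinguishable \<epsilon> \<delta> (K i z) (L i z) \<and>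
      (\<forall>a. fst z = Some a \<longrightarrow> map_pmf fst (K i z) = map_pmf Some (f i a)) \<and>
      (\<forall>b. snd z = Some b \<longrightarrow> map_pmf snd (L i z) = map_pmf Some (g i b))"
    by metis
  let ?z = "(Some a1, Some a2)"
  have z: "?z \<in> \<Psi> 0" using a by (force simp: \<Psi>_def star_rel_def)
  \<comment> \<open>A lifting prescribes only the first marginal on the left and the second on the
    right, so K is followed through \<open>fst\<close> and L through \<open>snd\<close>.\<close>
  have "set_pmf (kleisli_iter K n ?z) \<subseteq> \<Psi> n \<and>
      map_pmf fst (kleisli_iter K n ?z) = map_pmf Some (kleisli_iter f n a1)"
    by (rule kleisli_iter_projection[where \<Psi> = \<Psi> and h = fst]) (use KL z in auto)
  moreover have "set_pmf (kleisli_iter L n ?z) \<subseteq> \<Psi> n \<and>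
      map_pmf snd (kleisli_iter L n ?z) = map_pmf Some (kleisli_iter g n a2)"
    by (rule kleisli_iter_projection[where \<Psi> = \<Psi> and h = snd]) (use KL z in auto)
  moreover have "indistinguishable
      (\<epsilon> * sqrt (2 * real n * ln (1 / \<omega>)) + real n * \<epsilon> * (exp \<epsilon> - 1)) (real n * \<delta> + \<omega>)
      (kleisli_iter K n ?z) (kleisli_iter L n ?z)"
    by (rule advanced_composition[where \<Psi> = \<Psi>]) (use assms(1-3) KL z in auto)
  ultimately show "sym_approx_lifting
      (\<epsilon> * sqrt (2 * real n * ln (1 / \<omega>)) + real n * \<epsilon> * (exp \<epsilon> - 1)) (real n * \<delta> + \<omega>) (\<Phi> n)
      (spmf_of_pmf (kleisli_iter f n a1)) (spmf_of_pmf (kleisli_iter g n a2))"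
    unfolding sym_approx_lifting_spmf_of_pmf_iff \<Psi>_def by blast
qed

end
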